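(* Let $\mathcal{P}$ be an uncertain POMDP with finite state set $Q$, finite action set $A$, observation set $Z$, uncertain-parameter set $\Theta$, belief simplex $\mathcal{B}$ and belief update maps $f_a$ ($a\in A$), as defined in the context. Let $t^*\ge 1$ be an integer, $Q_u\subset Q$ a set of unsafe states, $\lambda\in\mathbb{R}$, $g:[0,1]\to\mathbb{R}$ a function, and let $$\mathcal{B}_u^s=\{\,b\in\mathcal{B} : g(b(q))>\lambda \text{ for all } q\in Q_u\,\}.$$ Let $\mathcal{B}_0\subset\mathcal{B}$ be a set of initial beliefs with $\mathcal{B}_0\cap\mathcal{B}_u^s=\emptyset$. Suppose there exists a function $B:\mathbb{Z}\times\mathcal{B}\to\mathbb{R}$ such that (1) $B(t^*,b)>0$ for all $b\in\mathcal{B}_u^s$; (2) $B(0,b)<0$ for all $b\in\mathcal{B}_0$; (3) $B\big(t,f_a(b,\theta,z)\big)-B(t-1,b)\le 0$ for all $t\in\{1,2,\ldots,t^*\}$, all $a\in A$, $\theta\in\Theta$, $z\in Z$ and $b\in\mathcal{B}$ for which $f_a(b,\theta,z)$ is defined. Then there is no solution $(b_0,b_1,\ldots,b_{t^*})$ of the belief update equation, for any sequence of actions in $A$, any sequence of observations in $Z$ and any $\theta\in\Theta$, such that $b_0\in\mathcal{B}_0$ and $b_{t^*}\in\mathcal{B}_u^s$.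
   Context: Uncertain POMDP: $Q$ is a finite set of states, $A$ a finite set of actions, $Z$ a set of observations, $O:Q\times A\times Z\to[0,1]$ a (known) observation probability function, and $T:Q\times A\times Q\to[0,1]$ a transition probability function, some of whose entries are uncertain. Namely, there is a set $T_u\subset Q\times A\times Q$ of triplets and constants $0\le\underline{l}_{q,a,q'}\le\overline{l}_{q,a,q'}\le 1$ for $(q,a,q')\in T_u$. The uncertain-parameter set is $$\Theta=\{\theta=(\theta_{q,a,q'})_{(q,a,q')\in T_u} : \theta_{q,a,q'}\in[\underline{l}_{q,a,q'},\overline{l}_{q,a,q'}] \text{ for all }(q,a,q')\in T_u\}.$$ For $\theta\in\Theta$, let $T_\theta(q,a,q')=\theta_{q,a,q'}$ if $(q,a,q')\in T_u$, and let $T_\theta(q,a,q')=T(q,a,q')$ (a given number in $[0,1]$) otherwise. Belief simplex: $\mathcal{B}=\{b\in[0,1]^{Q} : \sum_{q\in Q}b(q)=1\}$. Belief update maps: for $a\in A$, $\theta\in\Theta$, $z\in Z$, $b\in\mathcal{B}$, $f_a(b,\theta,z)\in\mathcal{B}$ is the vector with entries $$f_a^{q'}(b,\theta,z)=\frac{O(q',a,z)\sum_{q\in Q}T_\theta(q,a,q')\,b(q)}{\sum_{q''\in Q}O(q'',a,z)\sum_{q\in Q}T_\theta(q,a,q'')\,b(q)},\qquad q'\in Q,$$ defined whenever the denominator is nonzero. Solution: a sequence $(b_0,\ldots,b_{t^*})$ in $\mathcal{B}$ is a solution of the belief update equation for actions $a_0,\ldots,a_{t^*-1}\in A$ (arbitrary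 switching), observations $z_1,\ldots,z_{t^*}\in Z$ and parameter $\theta\in\Theta$ if, for every $t\in\{1,\ldots,t^*\}$, $f_{a_{t-1}}(b_{t-1},\theta,z_t)$ is defined and $b_t=f_{a_{t-1}}(b_{t-1},\theta,z_t)$. *)

theory Defs
  imports Complex_Main "HOL-Library.FuncSet"
begin

text \<open>The fields \<open>lower\<close> and \<open>upper\<close> only matter on \<open>uncertain\<close>, and \<open>trans_prob\<close> only matters off it.
  The rows of \<open>obs_prob\<close> and \<open>trans_prob\<close> are not required to sum to one.\<close>

record ('q, 'a, 'z) pomdp =
  obs_prob :: "'q \<Rightarrow> 'a \<Rightarrow> 'z \<Rightarrow> real"
  trans_prob :: "'q \<Rightarrow> 'a \<Rightarrow> 'q \<Rightarrow> real"
  uncertain :: "('q \<times> 'a \<times> 'q) set"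
  lower :: "'q \<times> 'a \<times> 'q \<Rightarrow> real"
  upper :: "'q \<times> 'a \<times> 'q \<Rightarrow> real"

definition uncertain_pomdp :: "('q, 'a, 'z) pomdp \<Rightarrow> bool" where
  "uncertain_pomdp P \<longleftrightarrow>
     (\<forall>q a z. obs_prob P q a z \<in> {0..1}) \<and>
     (\<forall>q a q'. trans_prob P q a q' \<in> {0..1}) \<and>
     (\<forall>x\<in>uncertain P. 0 \<le> lower P x \<and> lower P x \<le> upper P x \<and> upper P x \<le> 1)"

definition parameters :: "('q, 'a, 'z) pomdp \<Rightarrow> ('q \<times> 'a \<times> 'q \<Rightarrow> real) set" where
  "parameters P = (\<Pi>\<^sub>E x\<in>uncertain P. {lower P x..upper P x})"

definition trans_at ::
  "('q, 'a, 'z) pomdp \<Rightarrow> ('q \<times> 'a \<times> 'q \<Rightarrow> real) \<Rightarrow> 'q \<Rightarrow> 'a \<Rightarrow> 'q \<Rightarrow> real" where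
  "trans_at P \<theta> q a q' = (if (q, a, q') \<in> uncertain P then \<theta> (q, a, q') else trans_prob P q a q')"

definition beliefs :: "('q::finite \<Rightarrow> real) set" where
  "beliefs = {b. (\<forall>q. b q \<in> {0..1}) \<and> (\<Sum>q\<in>UNIV. b q) = 1}"

definition update_weight ::
  "('q::finite, 'a, 'z) pomdp \<Rightarrow> 'a \<Rightarrow> ('q \<Rightarrow> real) \<Rightarrow> ('q \<times> 'a \<times> 'q \<Rightarrow> real) \<Rightarrow> 'z \<Rightarrow> 'q \<Rightarrow> real" where
  "update_weight P a b \<theta> z q' = obs_prob P q' a z * (\<Sum>q\<in>UNIV. trans_at P \<theta> q a q' * b q)"

definition update_defined ::
  "('q::finite, 'a, 'z) pomdp \<Rightarrow> 'a \<Rightarrow> ('q \<Rightarrow> real) \<Rightarrow> ('q \<times> 'a \<times> 'q \<Rightarrow> real) \<Rightarrow> 'z \<Rightarrow> bool" where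
  "update_defined P a b \<theta> z \<longleftrightarrow> (\<Sum>q''\<in>UNIV. update_weight P a b \<theta> z q'') \<noteq> 0"

text \<open>Only meaningful under \<open>update_defined\<close>: otherwise it is the zero vector, as \<open>x / 0 = 0\<close>.\<close>

definition belief_update ::
  "('q::finite, 'a, 'z) pomdp \<Rightarrow> 'a \<Rightarrow> ('q \<Rightarrow> real) \<Rightarrow> ('q \<times> 'a \<times> 'q \<Rightarrow> real) \<Rightarrow> 'z \<Rightarrow> 'q \<Rightarrow> real" where
  "belief_update P a b \<theta> z =
     (\<lambda>q'. update_weight P a b \<theta> z q' / (\<Sum>q''\<in>UNIV. update_weight P a b \<theta> z q''))"

text \<open>The finite sequences \<open>b\<^sub>0, \<dots>, b\<^sub>N\<close>, \<open>a\<^sub>0, \<dots>, a\<^sub>N\<^sub>-\<^sub>1\<close> and \<open>z\<^sub>1, \<dots>, z\<^sub>N\<close> are represented by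
  functions on \<^typ>\<open>nat\<close> whose other values are irrelevant.\<close>

definition belief_solution ::
  "('q::finite, 'a, 'z) pomdp \<Rightarrow> ('q \<times> 'a \<times> 'q \<Rightarrow> real) \<Rightarrow> nat \<Rightarrow>
   (nat \<Rightarrow> 'a) \<Rightarrow> (nat \<Rightarrow> 'z) \<Rightarrow> (nat \<Rightarrow> 'q \<Rightarrow> real) \<Rightarrow> bool" where
  "belief_solution P \<theta> N a z b \<longleftrightarrow>
     (\<forall>t\<in>{0..N}. b t \<in> beliefs) \<and>
     (\<forall>t\<in>{1..N}. update_defined P (a (t - 1)) (b (t - 1)) \<theta> (z t) \<and>
        b t = belief_update P (a (t - 1)) (b (t - 1)) \<theta> (z t))"

definition unsafe_beliefs :: "'q::finite set \<Rightarrow> (real \<Rightarrow> real) \<Rightarrow> real \<Rightarrow> ('q \<Rightarrow> real) set" where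
  "unsafe_beliefs Qu g lam = {b \<in> beliefs. \<forall>q\<in>Qu. g (b q) > lam}"

text \<open>The belief simplex is closed under the defined updates, so the values of a function
  on beliefs outside \<^const>\<open>beliefs\<close> never enter conditions about these updates.\<close>

lemma update_weight_nonneg:
  assumes "uncertain_pomdp P" "\<theta> \<in> parameters P" "b \<in> beliefs"
  shows "update_weight P a b \<theta> z q' \<ge> 0"
proof -
  have "trans_at P \<theta> q a q' \<ge> 0" for q
  proof (cases "(q, a, q') \<in> uncertain P")
    case True
    then have "lower P (q, a, q') \<le> \<theta> (q, a, q')"
      using assms(2) by (auto simp: parameters_def dest: PiE_mem)
    moreover have "0 \<le> lower P (q, a, q')"
      using True assms(1) by (auto simp: uncertain_pomdp_def)
    ultimately show ?thesis
      using True by (simp add: trans_at_def)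
  qed (use assms(1) in \<open>auto simp: trans_at_def uncertain_pomdp_def\<close>)
  moreover have "b q \<ge> 0" for q
    using assms(3) by (auto simp: beliefs_def)
  moreover have "obs_prob P q' a z \<ge> 0"
    using assms(1) by (auto simp: uncertain_pomdp_def)
  ultimately show ?thesis
    by (simp add: update_weight_def sum_nonneg)
qed

lemma belief_update_in_beliefs:
  assumes "uncertain_pomdp P" "\<theta> \<in> parameters P" "b \<in> beliefs" "update_defined P a b \<theta> z"
  shows "belief_update P a b \<theta> z \<in> beliefs"
proof -
  let ?w = "update_weight P a b \<theta> z"
  have nn: "?w q \<ge> 0" for q
    using update_weight_nonneg[OF assms(1-3)] .
  then have pos: "sum ?w UNIV > 0"
    using assms(4) by (simp add: update_defined_def sum_nonneg less_le)
  have "?w q \<le> sum ?w UNIV" for q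
    by (rule member_le_sum) (auto simp: nn)
  then show ?thesis
    using nn pos by (auto simp: beliefs_def belief_update_def sum_divide_distrib[symmetric])
qed

end

theory Submission
  imports Defs
begin

text \<open>\<open>B\<close> acts as a time-dependent barrier certificate: the decrease condition
  makes the sequence of values \<open>B t (b t)\<close> nonincreasing along every solution, whatever
  the actions, observations and parameter. A solution that starts in \<open>\<B>\<^sub>0\<close>
  starts with a negative value, so its value at time \<open>tstar\<close> is still negative, whereas
  every belief in the unsafe set has a positive value there.\<close>

theorem theorem1:
  fixes P :: "('q::finite, 'a::finite, 'z) pomdp"
    and tstar :: nat
    and Qu :: "'q set"
    and lam :: real
    and g :: "real \<Rightarrow> real"
    and \<B>\<^sub>0 :: "('q \<Rightarrow> real) set"
    and B :: "int \<Rightarrow> ('q \<Rightarrow> real) \<Rightarrow> real"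
  assumes "uncertain_pomdp P"
    and "tstar \<ge> 1"
    and "\<B>\<^sub>0 \<subseteq> beliefs"
    and "\<B>\<^sub>0 \<inter> unsafe_beliefs Qu g lam = {}"
    and "\<And>b. b \<in> unsafe_beliefs Qu g lam \<Longrightarrow> B (int tstar) b > 0"
    and "\<And>b. b \<in> \<B>\<^sub>0 \<Longrightarrow> B 0 b < 0"
    and "\<And>t a \<theta> z b. t \<in> {1..int tstar} \<Longrightarrow> \<theta> \<in> parameters P \<Longrightarrow> b \<in> beliefs \<Longrightarrow>
           update_defined P a b \<theta> z \<Longrightarrow> B t (belief_update P a b \<theta> z) - B (t - 1) b \<le> 0"
  shows "\<not> (\<exists>a z \<theta> b. \<theta> \<in> parameters P \<and> belief_solution P \<theta> tstar a z b \<and>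
           b 0 \<in> \<B>\<^sub>0 \<and> b tstar \<in> unsafe_beliefs Qu g lam)"
proof
  assume "\<exists>a z \<theta> b. \<theta> \<in> parameters P \<and> belief_solution P \<theta> tstar a z b \<and>
           b 0 \<in> \<B>\<^sub>0 \<and> b tstar \<in> unsafe_beliefs Qu g lam"
  then obtain a z \<theta> b where \<theta>: "\<theta> \<in> parameters P" and sol: "belief_solution P \<theta> tstar a z b"
    and init: "b 0 \<in> \<B>\<^sub>0" and final: "b tstar \<in> unsafe_beliefs Qu g lam"
    by blast
  \<comment> \<open>The bound \<open>t \<le> tstar\<close> is carried through the induction because
    both the update equation and the decrease condition are available only up to time
    \<open>tstar\<close>.\<close>
  have "B (int t) (b t) \<le> B 0 (b 0)" if "t \<le> tstar" for t
    using that
  proof (induction t)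
    case (Suc t)
    have bel: "b t \<in> beliefs"
      using sol Suc.prems by (simp add: belief_solution_def)
    have "Suc t \<in> {1..tstar}"
      using Suc.prems by simp
    \<comment> \<open>The solution property at time \<open>Suc t\<close> speaks of indices
      \<open>Suc t - 1\<close>, which \<open>diff_Suc_1\<close> turns into \<open>t\<close>.\<close>
    then have dfd: "update_defined P (a t) (b t) \<theta> (z (Suc t))"
      and upd: "b (Suc t) = belief_update P (a t) (b t) \<theta> (z (Suc t))"
      using sol unfolding belief_solution_def by (metis diff_Suc_1)+
    \<comment> \<open>Time in \<open>B\<close> is an integer, so the second term is kept as
      \<open>int (Suc t) - 1\<close> to match the decrease condition; it simplifies to
      \<open>int t\<close> afterwards.\<close>
    have "B (int (Suc t)) (belief_update P (a t) (b t) \<theta> (z (Suc t)))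
        - B (int (Suc t) - 1) (b t) \<le> 0"
      using Suc.prems by (intro assms(7)[OF _ \<theta> bel dfd]) simp
    then have "B (int (Suc t)) (b (Suc t)) \<le> B (int t) (b t)"
      by (simp add: upd)
    then show ?case
      using Suc by simp
  qed simp
  then have "B (int tstar) (b tstar) \<le> B 0 (b 0)"
    by simp
  with assms(5)[OF final] assms(6)[OF init] show False
    by simp
qed

end
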